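(* Let $F:\mathbb{R}^n\to\mathbb{R}^n$ be a $C^1$ map. For $x\in\mathbb{R}^n$ let $\lambda_1(x),\dots,\lambda_n(x)$ be the eigenvalues, counted with multiplicity, of the symmetric matrix $JF(x)+JF(x)^T$. Suppose that $0\notin\mathrm{Spec}(F)$ and that one of the following conditions holds: (i) $\mathrm{Spec}(F+F^T)\subseteq(-\infty,0)$ and there exist $M_1,M_2>0$ such that for all $x\in\mathbb{R}^n$ $$\sum_{i=1}^n\lambda_i(x)>-M_1\quad\text{and}\quad\prod_{i=1}^n|\lambda_i(x)|>M_2;$$ (ii) $\mathrm{Spec}(F+F^T)\subseteq(0,+\infty)$ and there exist $M_1,M_2>0$ such that for all $x\in\mathbb{R}^n$ $$\sum_{i=1}^n\lambda_i(x)<M_1\quad\text{and}\quad\prod_{i=1}^n\lambda_i(x)>M_2.$$ Then $F$ is injective.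
   Context: For a $C^1$ map $F:\mathbb{R}^n\to\mathbb{R}^n$ with Jacobian matrix $JF(x)$ at $x$, $\mathrm{Spec}(F)$ denotes the set of all (complex) eigenvalues of the matrices $JF(x)$, as $x$ ranges over all of $\mathbb{R}^n$, and $\mathrm{Spec}(F+F^T)$ denotes the set of all eigenvalues of the symmetric matrices $JF(x)+JF(x)^T$, as $x$ ranges over all of $\mathbb{R}^n$. *)

theory Defs
  imports "HOL-Analysis.Analysis" "HOL-Computational_Algebra.Computational_Algebra"
begin

definition C1_map :: "(real^'n \<Rightarrow> real^'n) \<Rightarrow> bool" where
  "C1_map F \<longleftrightarrow>
     (\<forall>x. F differentiable (at x)) \<and> continuous_on UNIV (\<lambda>x. jacobian F (at x))"

definition eigenvalues :: "'a::field^'n^'n \<Rightarrow> 'a set" where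
  "eigenvalues A = {c. \<exists>v. v \<noteq> 0 \<and> A *v v = c *s v}"

definition charpoly :: "'a::comm_ring_1^'n^'n \<Rightarrow> 'a poly" where
  "charpoly A = det (\<chi> i j. (if i = j then [:0, 1:] else 0) - [:A $ i $ j:])"

text \<open>Eigenvalues in the field \<open>'a\<close>, counted with algebraic multiplicity. It is used below
  only for real symmetric matrices, whose eigenvalues are all real, so that working over the
  reals loses none of them.\<close>

definition eigenvalue_mset :: "'a::field^'n^'n \<Rightarrow> 'a multiset" where
  "eigenvalue_mset A = proots (charpoly A)"

definition sym_jacobian :: "(real^'n \<Rightarrow> real^'n) \<Rightarrow> real^'n \<Rightarrow> real^'n^'n" where
  "sym_jacobian F x = jacobian F (at x) + transpose (jacobian F (at x))"

definition Spec :: "(real^'n \<Rightarrow> real^'n) \<Rightarrow> complex set" where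
  "Spec F = (\<Union>x. eigenvalues (\<chi> i j. complex_of_real (jacobian F (at x) $ i $ j)))"

text \<open>The set \<open>Spec(F + F\<^sup>T)\<close>.\<close>

definition Spec_sym :: "(real^'n \<Rightarrow> real^'n) \<Rightarrow> real set" where
  "Spec_sym F = (\<Union>x. eigenvalues (sym_jacobian F x))"

end

(* The smallest eigenvalue of a symmetric matrix is the minimum of its Rayleigh quotient, so the
   sign condition makes the quadratic form v \<bullet> JF(x) v definite for every x. Applying Rolle's
   theorem to t \<mapsto> d \<bullet> F(y + t d) with d = x - y then excludes F x = F y for x \<noteq> y. *)
theory Submission
  imports Defs
begin

lemma inner_transpose_matrix_vector:
  fixes A :: "real^'n^'n"
  shows "v \<bullet> (transpose A *v w) = w \<bullet> (A *v v)"
  by (simp add: dot_matrix_vector_mul inner_commute flip: dot_lmul_matrix)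

text \<open>A zero of a nonnegative form is a global minimum of it, so every directional derivative
  vanishes there. In the direction \<open>B *v v\<close> that derivative is twice the squared norm
  of \<open>B *v v\<close>.\<close>

lemma psd_form_zero_imp_kernel:
  fixes B :: "real^'n^'n"
  assumes sym: "transpose B = B" and psd: "\<And>w. 0 \<le> w \<bullet> (B *v w)" and zero: "v \<bullet> (B *v v) = 0"
  shows "B *v v = 0"
proof -
  define w where "w = B *v v"
  define f where "f t = 2 * t * (w \<bullet> w) + t\<^sup>2 * (w \<bullet> (B *v w))" for t :: real
  \<comment> \<open>By symmetry both cross terms of the form at \<open>v + t *\<^sub>R w\<close>
    equal \<open>w \<bullet> w\<close>, which gives the linear coefficient of
    \<open>f\<close>.\<close>
  have "v \<bullet> (B *v w) = w \<bullet> w"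
    using inner_transpose_matrix_vector[of v B w] sym by (simp add: w_def)
  then have f: "(v + t *\<^sub>R w) \<bullet> (B *v (v + t *\<^sub>R w)) = f t" for t
    using zero
    by (simp add: f_def w_def[symmetric] matrix_vector_right_distrib matrix_vector_mult_scaleR
        inner_add_left inner_add_right power2_eq_square algebra_simps)
  have "(f has_real_derivative 2 * (w \<bullet> w)) (at 0)"
    unfolding f_def by (auto intro!: derivative_eq_intros)
  \<comment> \<open>Since \<open>f 0 = 0\<close> and \<open>f\<close> takes only values of the form,
    the minimum is global; the radius 1 is arbitrary.\<close>
  moreover have "\<forall>t. \<bar>0 - t\<bar> < 1 \<longrightarrow> f 0 \<le> f t"
    using psd[of "v + _ *\<^sub>R w"] by (simp add: f) (simp add: f_def)
  ultimately have "2 * (w \<bullet> w) = 0"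
    by (rule DERIV_local_min[OF _ zero_less_one])
  then show ?thesis by (simp add: w_def)
qed

text \<open>The form attains its minimum \<open>c\<close> on the compact unit sphere, and scaling
  extends the bound to all vectors. The minimizer is then an eigenvector for
  \<open>c\<close>.\<close>

lemma symmetric_matrix_min_eigenvalue:
  fixes S :: "real^'n^'n"
  assumes sym: "transpose S = S"
  obtains c where "c \<in> eigenvalues S" "\<And>w. c * (w \<bullet> w) \<le> w \<bullet> (S *v w)"
proof -
  have "continuous_on (sphere 0 1) (\<lambda>w. w \<bullet> (S *v w))"
    by (intro continuous_intros bounded_linear.continuous_on[OF matrix_vector_mul_bounded_linear])
  \<comment> \<open>Any unit vector serves here: attaining the infimum requires a nonempty
    sphere.\<close>
  moreover have "axis undefined 1 \<in> sphere (0::real^'n) 1" by simp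
  ultimately obtain v where v: "norm v = 1"
    and min: "\<And>u. norm u = 1 \<Longrightarrow> v \<bullet> (S *v v) \<le> u \<bullet> (S *v u)"
    using continuous_attains_inf[of "sphere (0::real^'n) 1" "\<lambda>w. w \<bullet> (S *v w)"] by auto
  define c where "c = v \<bullet> (S *v v)"
  have rayleigh: "c * (w \<bullet> w) \<le> w \<bullet> (S *v w)" for w
  proof (cases "w = 0")
    case False
    then have "c \<le> (inverse (norm w) *\<^sub>R w) \<bullet> (S *v (inverse (norm w) *\<^sub>R w))"
      unfolding c_def by (intro min) simp
    also have "\<dots> = (w \<bullet> (S *v w)) / (w \<bullet> w)"
      by (simp add: matrix_vector_mult_scaleR dot_square_norm power2_eq_square divide_simps)
    finally show ?thesis using False by (simp add: pos_le_divide_eq)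
  qed simp
  \<comment> \<open>After this shift the Rayleigh bound says that \<open>B\<close> is positive
    semidefinite, and its form vanishes at \<open>v\<close>; hence \<open>v\<close> lies in the
    kernel of \<open>B\<close>.\<close>
  define B where "B = S - mat c"
  have B: "B *v w = S *v w - c *\<^sub>R w" for w
    by (simp add: B_def matrix_vector_mult_diff_rdistrib flip: scalar_mult_eq_scaleR)
      (simp add: vec_eq_iff matrix_vector_mult_def mat_def if_distrib if_distribR sum.delta cong: if_cong)
  have "transpose B = B"
    using sym by (simp add: B_def transpose_def mat_def vec_eq_iff)
  then have "B *v v = 0"
    using rayleigh v
    by (intro psd_form_zero_imp_kernel)
      (auto simp: B inner_diff_right c_def[symmetric] dot_square_norm)
  then have "c \<in> eigenvalues S"
    using v by (auto simp: eigenvalues_def B scalar_mult_eq_scaleR intro!: exI[of _ v])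
  with rayleigh that show ?thesis by blast
qed

lemma positive_eigenvalues_imp_positive_definite:
  fixes S :: "real^'n^'n"
  assumes "transpose S = S" "eigenvalues S \<subseteq> {0<..}" "v \<noteq> 0"
  shows "0 < v \<bullet> (S *v v)"
proof -
  obtain c where "c \<in> eigenvalues S" and le: "c * (v \<bullet> v) \<le> v \<bullet> (S *v v)"
    using symmetric_matrix_min_eigenvalue[OF assms(1)] by blast
  then have "0 < c * (v \<bullet> v)" using assms by auto
  with le show ?thesis by linarith
qed

lemma matrix_vector_mult_minus_left:
  fixes A :: "'a::ring_1^'n^'m"
  shows "(- A) *v v = - (A *v v)"
  by (simp add: vec_eq_iff matrix_vector_mult_def sum_negf)

lemma eigenvalues_uminus_iff: "c \<in> eigenvalues (- A) \<longleftrightarrow> - c \<in> eigenvalues A"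
proof -
  have "- A *v v = c *s v \<longleftrightarrow> A *v v = - c *s v" for v
    by (metis matrix_vector_mult_minus_left vector_smult_lneg minus_minus)
  then show ?thesis
    by (simp add: eigenvalues_def)
qed

text \<open>Passing to \<open>- S\<close> flips the sign of the spectrum and of the form, which
  reduces this to the positive case.\<close>

lemma negative_eigenvalues_imp_negative_definite:
  fixes S :: "real^'n^'n"
  assumes "transpose S = S" "eigenvalues S \<subseteq> {..<0}" "v \<noteq> 0"
  shows "v \<bullet> (S *v v) < 0"
proof -
  have "transpose (- S) = - S"
    using assms(1) by (simp add: transpose_def vec_eq_iff)
  moreover have "eigenvalues (- S) \<subseteq> {0<..}"
    using assms(2) by (force simp: eigenvalues_uminus_iff)
  ultimately have "0 < v \<bullet> ((- S) *v v)"
    using assms(3) by (rule positive_eigenvalues_imp_positive_definite)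
  then show ?thesis by (simp add: matrix_vector_mult_minus_left)
qed

lemma transpose_sym_jacobian: "transpose (sym_jacobian F x) = sym_jacobian F x"
  by (simp add: sym_jacobian_def transpose_def vec_eq_iff add.commute)

text \<open>A matrix and its transpose have the same quadratic form, so definiteness of the
  symmetrized Jacobian carries over to the Jacobian itself.\<close>

lemma sym_jacobian_form:
  "v \<bullet> (sym_jacobian F x *v v) = 2 * (v \<bullet> (jacobian F (at x) *v v))"
  by (simp add: sym_jacobian_def matrix_vector_mult_add_rdistrib inner_add_right
      inner_transpose_matrix_vector del: transpose_matrix_vector)

lemma inj_if_jacobian_form_nonzero:
  fixes F :: "real^'n \<Rightarrow> real^'n"
  assumes diff: "\<And>x. F differentiable (at x)"
    and nonzero: "\<And>x v. v \<noteq> 0 \<Longrightarrow> v \<bullet> (jacobian F (at x) *v v) \<noteq> 0"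
  shows "inj F"
proof (rule injI, rule ccontr)
  fix x y assume eq: "F x = F y" and neq: "x \<noteq> y"
  define d where "d = x - y"
  \<comment> \<open>Pairing with the fixed vector \<open>d\<close> makes the function scalar, as
    Rolle's theorem requires; by the chain rule its derivative is the Jacobian form at
    \<open>d\<close>.\<close>
  define g where "g t = d \<bullet> F (y + t *\<^sub>R d)" for t :: real
  have g: "(g has_real_derivative d \<bullet> (jacobian F (at (y + t *\<^sub>R d)) *v d)) (at t)" for t
  proof -
    have F: "(F has_derivative (\<lambda>h. jacobian F (at (y + t *\<^sub>R d)) *v h)) (at (y + t *\<^sub>R d))"
      using diff jacobian_works by blast
    have "((\<lambda>t. y + t *\<^sub>R d) has_derivative (\<lambda>s. s *\<^sub>R d)) (at t)"
      by (auto intro!: derivative_eq_intros)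
    from has_derivative_inner_right[OF has_derivative_compose[OF this F], of d]
    show ?thesis
      by (simp add: g_def[abs_def] has_field_derivative_def matrix_vector_mult_scaleR
          mult_commute_abs)
  qed
  have "g 0 = g 1" by (simp add: g_def d_def eq)
  moreover have "continuous_on {0..1} g"
    using g by (meson DERIV_isCont continuous_at_imp_continuous_on)
  ultimately obtain t where "(\<lambda>s. d \<bullet> (jacobian F (at (y + t *\<^sub>R d)) *v d) * s) = (\<lambda>s. 0)"
    using Rolle_deriv[of 0 1 g "\<lambda>t s. d \<bullet> (jacobian F (at (y + t *\<^sub>R d)) *v d) * s"] g
    by (auto simp: has_field_derivative_def)
  \<comment> \<open>Rolle's theorem yields a vanishing linear map; its value at 1 is the derivative
    of \<open>g\<close> at \<open>t\<close>.\<close>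
  from fun_cong[OF this, of 1] show False
    using nonzero[of d] neq by (simp add: d_def)
qed

theorem theorem1p7:
  fixes F :: "real^'n \<Rightarrow> real^'n"
  assumes "C1_map F"
    and "0 \<notin> Spec F"
    and "(Spec_sym F \<subseteq> {..<0} \<and>
            (\<exists>M1>0. \<exists>M2>0. \<forall>x.
               (\<Sum>c\<in>#eigenvalue_mset (sym_jacobian F x). c) > - M1 \<and>
               (\<Prod>c\<in>#eigenvalue_mset (sym_jacobian F x). \<bar>c\<bar>) > M2))
       \<or> (Spec_sym F \<subseteq> {0<..} \<and>
            (\<exists>M1>0. \<exists>M2>0. \<forall>x.
               (\<Sum>c\<in>#eigenvalue_mset (sym_jacobian F x). c) < M1 \<and>
               (\<Prod>c\<in>#eigenvalue_mset (sym_jacobian F x). c) > M2))"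
  shows "inj F"
proof (rule inj_if_jacobian_form_nonzero)
  show "F differentiable (at x)" for x
    using assms(1) by (simp add: C1_map_def)
next
  fix x v :: "real^'n"
  assume "v \<noteq> 0"
  have "eigenvalues (sym_jacobian F x) \<subseteq> Spec_sym F"
    by (auto simp: Spec_sym_def)
  with assms(3) consider "eigenvalues (sym_jacobian F x) \<subseteq> {..<0}"
    | "eigenvalues (sym_jacobian F x) \<subseteq> {0<..}"
    by blast
  then have "v \<bullet> (sym_jacobian F x *v v) \<noteq> 0"
    using negative_eigenvalues_imp_negative_definite[OF transpose_sym_jacobian _ \<open>v \<noteq> 0\<close>]
      positive_eigenvalues_imp_positive_definite[OF transpose_sym_jacobian _ \<open>v \<noteq> 0\<close>]
    by cases (metis less_irrefl)+
  then show "v \<bullet> (jacobian F (at x) *v v) \<noteq> 0"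
    by (simp add: sym_jacobian_form)
qed

end
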